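(* Let $\alpha,\beta,\gamma,a,b,c,z\in\mathbb{C}$ and $p\ge 0$ with $\mathrm{Re}(\alpha)>0$, $\mathrm{Re}(c)>\mathrm{Re}(b)>0$ and $|z|<1$. Then $$\Delta_{a}\,{}^{ML}F_{p}(a,b;c;z)=\frac{bz}{c}\;{}^{ML}F_{p}(a+1,b+1;c+1;z),$$ where $\Delta_{a}\,{}^{ML}F_{p}(a,b;c;z)={}^{ML}F_{p}(a+1,b;c;z)-{}^{ML}F_{p}(a,b;c;z)$.
   Context: The three-parameter Mittag-Leffler function is $E_{\alpha,\beta}^{\gamma}(z)=\sum_{n=0}^{\infty}\frac{(\gamma)_n}{\Gamma(\alpha n+\beta)}\frac{z^n}{n!}$ for $\alpha,\beta,\gamma\in\mathbb{C}$, $\mathrm{Re}(\alpha)>0$, where $(\gamma)_n=\gamma(\gamma+1)\cdots(\gamma+n-1)$, $(\gamma)_0=1$. The ML-generalized beta function is ${}^{ML}B_{p}(x,y)=\int_{0}^{1}t^{x-1}(1-t)^{y-1}E_{\alpha,\beta}^{\gamma}\left(-\frac{p}{t(1-t)}\right)dt$ for $\mathrm{Re}(x)>0$, $\mathrm{Re}(y)>0$ (the parameters $\alpha,\beta,\gamma$ are suppressed in the notation), and $B(x,y)=\int_0^1 t^{x-1}(1-t)^{y-1}dt$ is the classical beta function. The ML-generalized Gauss hypergeometric function is ${}^{ML}F_{p}(a,b;c;z)=\sum_{n=0}^{\infty}(a)_n\frac{{}^{ML}B_{p}(b+n,c-b)}{B(b,c-b)}\frac{z^n}{n!}$ for $p\ge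 0$, $|z|<1$, $\mathrm{Re}(c)>\mathrm{Re}(b)>0$, $\mathrm{Re}(\alpha)>0$. *)

theory Defs
  imports "HOL-Analysis.Analysis"
begin

(* At the poles of Gamma, division by Gamma gives 0, which agrees with the value of the
   entire function 1 / Gamma there. *)
definition mittag_leffler3 :: "complex \<Rightarrow> complex \<Rightarrow> complex \<Rightarrow> complex \<Rightarrow> complex" where
  "mittag_leffler3 \<alpha> \<beta> \<gamma> z =
     (\<Sum>n. pochhammer \<gamma> n / Gamma (\<alpha> * of_nat n + \<beta>) * (z ^ n / fact n))"

(* The integrals below are Henstock-Kurzweil integrals, which extend both the Lebesgue and the
   improper Riemann integral; the values of the integrands at t = 0 and t = 1 are irrelevant. *)
definition beta_integral :: "complex \<Rightarrow> complex \<Rightarrow> complex" where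
  "beta_integral x y =
     integral {0..1} (\<lambda>t::real. of_real t powr (x - 1) * of_real (1 - t) powr (y - 1))"

definition beta_ML ::
  "complex \<Rightarrow> complex \<Rightarrow> complex \<Rightarrow> real \<Rightarrow> complex \<Rightarrow> complex \<Rightarrow> complex" where
  "beta_ML \<alpha> \<beta> \<gamma> p x y =
     integral {0..1} (\<lambda>t::real. of_real t powr (x - 1) * of_real (1 - t) powr (y - 1)
       * mittag_leffler3 \<alpha> \<beta> \<gamma> (of_real (- p / (t * (1 - t)))))"

definition hypergeom_ML ::
  "complex \<Rightarrow> complex \<Rightarrow> complex \<Rightarrow> real \<Rightarrow> complex \<Rightarrow> complex \<Rightarrow> complex \<Rightarrow> complex \<Rightarrow> complex" where
  "hypergeom_ML \<alpha> \<beta> \<gamma> p a b c z =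
     (\<Sum>n. pochhammer a n
        * (beta_ML \<alpha> \<beta> \<gamma> p (b + of_nat n) (c - b) / beta_integral b (c - b))
        * (z ^ n / fact n))"

definition forward_difference :: "(complex \<Rightarrow> complex) \<Rightarrow> complex \<Rightarrow> complex" where
  "forward_difference f a = f (a + 1) - f a"

end

theory Submission
  imports Defs
begin

text \<open>
  Since (a+1)_n - (a)_n = n (a+1)_{n-1}, the difference of the two series is, after an index shift,
  the series on the right termwise: the numerators are the same integrals, and the denominators
  agree by B(b+1, c-b) = (b/c) B(b, c-b). Convergence needs no information about the
  Mittag-Leffler function: the integrals arise from one fixed function f by multiplication with
  the monotone functions t^n, so by the second mean value theorem they are bounded in n as soon as
  one of them exists, and those that do not exist have the value 0.
\<close>

text \<open>Integrability of \<open>f\<close> need not be absolute, so comparing norms with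
  \<open>f\<close> is no option. The mean value point \<open>c\<close> depends on \<open>n\<close>,
  so the bound must be uniform in \<open>c\<close>: both indefinite integrals of \<open>f\<close>
  are continuous on a compact interval, hence bounded.\<close>

lemma bounded_moments_real:
  fixes f :: "real \<Rightarrow> real"
  assumes f: "f integrable_on {0..1}"
  shows "\<exists>K. \<forall>n. (\<lambda>t. t ^ n * f t) integrable_on {0..1} \<and> \<bar>integral {0..1} (\<lambda>t. t ^ n * f t)\<bar> \<le> K"
proof -
  have "bounded ((\<lambda>x. integral {0..x} f) ` {0..1})"
    by (intro compact_imp_bounded compact_continuous_image indefinite_integral_continuous_1 f) auto
  then obtain K1 where K1: "\<And>x. x \<in> {0..1} \<Longrightarrow> \<bar>integral {0..x} f\<bar> \<le> K1"
    unfolding bounded_iff by (metis image_eqI real_norm_def)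
  have "bounded ((\<lambda>x. integral {x..1} f) ` {0..1})"
    by (intro compact_imp_bounded compact_continuous_image indefinite_integral_continuous_1' f) auto
  then obtain K2 where K2: "\<And>x. x \<in> {0..1} \<Longrightarrow> \<bar>integral {x..1} f\<bar> \<le> K2"
    unfolding bounded_iff by (metis image_eqI real_norm_def)
  show ?thesis
  proof (intro exI[of _ "K1 + K2"] allI)
    fix n :: nat
    obtain c where c: "c \<in> {0..1}"
      and hi: "((\<lambda>t. t ^ n * f t) has_integral
                 (0 ^ n * integral {0..c} f + 1 ^ n * integral {c..1} f)) {0..1}"
      using second_mean_value_theorem_full[OF f, of "\<lambda>t. t ^ n"] by (auto intro: power_mono)
    \<comment> \<open>The value of t^n at the left endpoint is 1 for \<open>n = 0\<close> and 0
      otherwise, hence the case split.\<close>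
    have "\<bar>0 ^ n * integral {0..c} f\<bar> \<le> K1"
      using K1[OF c] by (cases n) auto
    with K2[OF c] hi show "(\<lambda>t. t ^ n * f t) integrable_on {0..1} \<and>
        \<bar>integral {0..1} (\<lambda>t. t ^ n * f t)\<bar> \<le> K1 + K2"
      by (auto simp: has_integral_iff)
  qed
qed

text \<open>The second mean value theorem concerns real integrands. As t^n is real, multiplying by
  it commutes with taking real and imaginary parts.\<close>

lemma bounded_moments_integrable:
  fixes f :: "real \<Rightarrow> complex"
  assumes f: "f integrable_on {0..1}"
  shows "\<exists>K. \<forall>n. norm (integral {0..1} (\<lambda>t. of_real t ^ n * f t)) \<le> K"
proof -
  have "(\<lambda>t. Re (f t)) integrable_on {0..1}" "(\<lambda>t. Im (f t)) integrable_on {0..1}"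
    using integrable_linear[OF f bounded_linear_Re] integrable_linear[OF f bounded_linear_Im]
    by (simp_all add: o_def)
  then obtain K1 K2 where
    K1: "\<And>n. (\<lambda>t. t ^ n * Re (f t)) integrable_on {0..1}"
        "\<And>n. \<bar>integral {0..1} (\<lambda>t. t ^ n * Re (f t))\<bar> \<le> K1" and
    K2: "\<And>n. (\<lambda>t. t ^ n * Im (f t)) integrable_on {0..1}"
        "\<And>n. \<bar>integral {0..1} (\<lambda>t. t ^ n * Im (f t))\<bar> \<le> K2"
    using bounded_moments_real by meson
  have "norm (integral {0..1} (\<lambda>t. of_real t ^ n * f t)) \<le> K1 + K2" for n
  proof -
    have Re: "Re (of_real t ^ n * f t) = t ^ n * Re (f t)"
      and Im: "Im (of_real t ^ n * f t) = t ^ n * Im (f t)" for t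
      by (simp_all flip: of_real_power)
    have int: "(\<lambda>t. of_real t ^ n * f t) integrable_on {0..1}"
      by (rule integrable_componentwise) (use K1(1) K2(1) in \<open>auto simp: Basis_complex_def Re Im\<close>)
    have "Re (integral {0..1} (\<lambda>t. of_real t ^ n * f t)) = integral {0..1} (\<lambda>t. t ^ n * Re (f t))"
      using integral_linear[OF int bounded_linear_Re] by (simp add: o_def Re)
    moreover have "Im (integral {0..1} (\<lambda>t. of_real t ^ n * f t)) = integral {0..1} (\<lambda>t. t ^ n * Im (f t))"
      using integral_linear[OF int bounded_linear_Im] by (simp add: o_def Im)
    ultimately show ?thesis
      using K1(2)[of n] K2(2)[of n] cmod_le[of "integral {0..1} (\<lambda>t. of_real t ^ n * f t)"] by simp
  qed
  then show ?thesis by blast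
qed

text \<open>Let \<open>N\<close> be the least exponent giving an integrable function. From
  \<open>N\<close> on, the moments are those of the integrable function t^N f; below
  \<open>N\<close> the integral takes its default value 0.\<close>

lemma bounded_moments:
  fixes f :: "real \<Rightarrow> complex"
  shows "\<exists>K. \<forall>n. norm (integral {0..1} (\<lambda>t. of_real t ^ n * f t)) \<le> K"
proof (cases "\<exists>n. (\<lambda>t. of_real t ^ n * f t) integrable_on {0..1}")
  case False
  then show ?thesis by (auto simp: not_integrable_integral)
next
  case True
  define N where "N = (LEAST n. (\<lambda>t. of_real t ^ n * f t) integrable_on {0..1})"
  have N: "(\<lambda>t. of_real t ^ N * f t) integrable_on {0..1}"
    unfolding N_def using True by (rule LeastI_ex)
  obtain K where K: "norm (integral {0..1} (\<lambda>t. of_real t ^ n * (of_real t ^ N * f t))) \<le> K" for n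
    using bounded_moments_integrable[OF N] by blast
  have "norm (integral {0..1} (\<lambda>t. of_real t ^ n * f t)) \<le> K" for n
  proof (cases "n < N")
    case True
    then have "integral {0..1} (\<lambda>t. of_real t ^ n * f t) = 0"
      using not_less_Least not_integrable_integral unfolding N_def by blast
    moreover have "0 \<le> K" using norm_ge_zero K order_trans by blast
    ultimately show ?thesis by simp
  next
    case False
    then show ?thesis
      using K[of "n - N"] by (simp flip: power_add mult.assoc)
  qed
  then show ?thesis by blast
qed

text \<open>At \<open>t = 0\<close> both sides vanish, because 0 \<open>powr\<close> anything is
  0.\<close>

lemma powr_add_of_nat_of_real:
  "complex_of_real t powr (x + of_nat n - 1) = of_real t powr (x - 1) * of_real t ^ n"
proof -
  have "x + of_nat n - 1 = (x - 1) + of_nat n" by simp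
  then show ?thesis by (cases "t = 0") (simp_all only: powr_add powr_complexpow of_real_eq_0_iff
        not_False_eq_True, simp_all)
qed

lemma bounded_beta_ML: "\<exists>K. \<forall>n. norm (beta_ML \<alpha> \<beta> \<gamma> p (x + of_nat n) y) \<le> K"
proof -
  define f where "f = (\<lambda>t::real. of_real t powr (x - 1) * of_real (1 - t) powr (y - 1)
       * mittag_leffler3 \<alpha> \<beta> \<gamma> (of_real (- p / (t * (1 - t)))))"
  have "beta_ML \<alpha> \<beta> \<gamma> p (x + of_nat n) y = integral {0..1} (\<lambda>t. of_real t ^ n * f t)" for n
    unfolding beta_ML_def f_def powr_add_of_nat_of_real by (simp only: mult_ac)
  then show ?thesis using bounded_moments[of f] by simp
qed

text \<open>On the open interval the integrand is continuous and its norm is the real Beta integrand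
  with parameters \<open>Re x\<close> and \<open>Re y\<close>. The two endpoints do not affect
  integrability.\<close>

lemma integrable_beta:
  assumes "Re x > 0" "Re y > 0"
  shows "(\<lambda>t::real. complex_of_real t powr (x - 1) * of_real (1 - t) powr (y - 1)) integrable_on {0..1}"
proof -
  have "(\<lambda>t::real. complex_of_real t powr (x - 1) * of_real (1 - t) powr (y - 1))
      absolutely_integrable_on {0<..<1}"
  proof (rule measurable_bounded_by_integrable_imp_absolutely_integrable)
    show "(\<lambda>t::real. complex_of_real t powr (x - 1) * of_real (1 - t) powr (y - 1))
        \<in> borel_measurable (lebesgue_on {0<..<1})"
      by (intro continuous_imp_measurable_on_sets_lebesgue continuous_intros) auto
    show "(\<lambda>t. t powr (Re x - 1) * (1 - t) powr (Re y - 1)) integrable_on {0<..<1}"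
      using has_integral_Beta_real[OF assms]
      by (auto simp: integrable_on_Icc_iff_Ioo has_integral_iff)
    show "norm (complex_of_real t powr (x - 1) * of_real (1 - t) powr (y - 1))
        \<le> t powr (Re x - 1) * (1 - t) powr (Re y - 1)" if "t \<in> {0<..<1}" for t
      using that by (simp add: norm_mult norm_powr_real_powr del: of_real_diff)
  qed simp
  then show ?thesis
    by (simp add: absolutely_integrable_on_def integrable_on_Icc_iff_Ioo)
qed

text \<open>Integration by parts: the derivative of t^x (1-t)^y integrates to 0.\<close>

lemma beta_integral_plus1:
  assumes x: "Re x > 0" and y: "Re y > 0"
  shows "(x + y) * beta_integral (x + 1) y = x * beta_integral x y"
proof -
  define g where "g = (\<lambda>u v t. complex_of_real t powr (u - 1) * of_real (1 - t) powr (v - 1))"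
  have g: "(g x y has_integral beta_integral x y) {0..1}"
    "(g (x + 1) y has_integral beta_integral (x + 1) y) {0..1}"
    unfolding g_def beta_integral_def using integrable_beta[of x y] integrable_beta[of "x + 1" y] x y
    by (simp_all only: integrable_integral plus_complex.sel one_complex.sel add_pos_pos zero_less_one)
  have "((\<lambda>t. x * g x y t - (x + y) * g (x + 1) y t) has_integral
      (of_real 1 powr x * of_real (1 - 1) powr y - of_real 0 powr x * of_real (1 - 0) powr y)) {0..1}"
  \<comment> \<open>The derivative may blow up at the endpoints, so differentiability is used only
    inside; continuity up to the endpoints comes from the positive real parts.\<close>
  proof (rule fundamental_theorem_of_calculus_interior)
    show "continuous_on {0..1} (\<lambda>t::real. complex_of_real t powr x * of_real (1 - t) powr y)"
      using x y by (intro continuous_intros) auto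
    fix t :: real
    assume t: "t \<in> {0<..<1}"
    \<comment> \<open>Differentiate in a complex variable, with \<open>s\<close> and
      \<open>1 - s\<close> off the branch cut, and then restrict to the real line.\<close>
    define s where "s = complex_of_real t"
    have s: "s \<notin> \<real>\<^sub>\<le>\<^sub>0" "1 - s \<notin> \<real>\<^sub>\<le>\<^sub>0" "s \<noteq> 0" "1 - s \<noteq> 0"
      using t by (auto simp: s_def complex_nonpos_Reals_iff)
    \<comment> \<open>Lowering both exponents by one exposes the common factor s^(x-1) (1-s)^(y-1),
      which leaves x (1-s) - y s = x - (x+y) s.\<close>
    have p: "s powr x = s * s powr (x - 1)" "(1 - s) powr y = (1 - s) * (1 - s) powr (y - 1)"
      using s by (simp_all add: powr_diff)
    have "((\<lambda>s. s powr x * (1 - s) powr y) has_field_derivative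
        x * s powr (x - 1) * (1 - s) powr y - y * (1 - s) powr (y - 1) * s powr x) (at s)"
      using s by (auto intro!: derivative_eq_intros)
    also have "x * s powr (x - 1) * (1 - s) powr y - y * (1 - s) powr (y - 1) * s powr x
        = x * g x y t - (x + y) * g (x + 1) y t"
      unfolding p g_def by (simp add: p flip: s_def) (simp add: algebra_simps)
    finally show "((\<lambda>t. of_real t powr x * of_real (1 - t) powr y) has_vector_derivative
        x * g x y t - (x + y) * g (x + 1) y t) (at t)"
      unfolding s_def by (auto dest: has_vector_derivative_real_field)
  qed simp
  moreover have "((\<lambda>t. x * g x y t - (x + y) * g (x + 1) y t) has_integral
      x * beta_integral x y - (x + y) * beta_integral (x + 1) y) {0..1}"
    by (intro has_integral_diff has_integral_mult_right g)
  ultimately have "of_real 1 powr x * of_real (1 - 1) powr y - of_real 0 powr x * of_real (1 - 0) powr y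
      = x * beta_integral x y - (x + y) * beta_integral (x + 1) y"
    by (rule has_integral_unique)
  then show ?thesis by simp
qed

text \<open>These are the terms of the binomial series of (1-z)^(-a), whose radius of convergence is
  1, or infinite when -a is a natural number.\<close>

lemma summable_norm_pochhammer_power:
  fixes a z :: complex
  assumes "norm z < 1"
  shows "summable (\<lambda>n. norm (pochhammer a n * (z ^ n / fact n)))"
proof -
  have "summable (\<lambda>n. norm ((- a gchoose n) * (- z) ^ n))"
    by (rule abs_summable_in_conv_radius)
       (use assms in \<open>auto simp: conv_radius_gchoose one_ereal_def\<close>)
  also have "(\<lambda>n. norm ((- a gchoose n) * (- z) ^ n)) = (\<lambda>n. norm (pochhammer a n * (z ^ n / fact n)))"
    by (auto simp: gbinomial_pochhammer norm_mult norm_divide norm_power)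
  finally show ?thesis .
qed

text \<open>Both products contain (a+1)_n; the remaining factors are a+1+n and a.\<close>

lemma pochhammer_forward_difference:
  fixes a :: "'a :: comm_ring_1"
  shows "pochhammer (a + 1) (Suc n) - pochhammer a (Suc n) = of_nat (Suc n) * pochhammer (a + 1) n"
  unfolding pochhammer_rec[of a] pochhammer_rec'[of "a + 1"] by (simp add: algebra_simps)

text \<open>The uniform bound on the numerators reduces this to the binomial series. With
  \<open>B\<close> arbitrary, it serves both denominators of the theorem.\<close>

lemma summable_hypergeom_ML:
  assumes "norm z < 1"
  shows "summable (\<lambda>n. pochhammer a n
    * (beta_ML \<alpha> \<beta> \<gamma> p (b + of_nat n) y / B) * (z ^ n / fact n))"
proof -
  obtain K where K: "norm (beta_ML \<alpha> \<beta> \<gamma> p (b + of_nat n) y) \<le> K" for n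
    using bounded_beta_ML by blast
  show ?thesis
  proof (rule summable_comparison_test')
    show "summable (\<lambda>n. K / norm B * norm (pochhammer a n * (z ^ n / fact n)))"
      by (intro summable_mult summable_norm_pochhammer_power assms)
    have "norm (pochhammer a n * (beta_ML \<alpha> \<beta> \<gamma> p (b + of_nat n) y / B) * (z ^ n / fact n))
      = norm (beta_ML \<alpha> \<beta> \<gamma> p (b + of_nat n) y) / norm B * norm (pochhammer a n * (z ^ n / fact n))"
      for n by (simp add: norm_mult norm_divide)
    then show "norm (pochhammer a n * (beta_ML \<alpha> \<beta> \<gamma> p (b + of_nat n) y / B) * (z ^ n / fact n))
      \<le> K / norm B * norm (pochhammer a n * (z ^ n / fact n))" for n
      by (simp only:) (intro mult_right_mono divide_right_mono K norm_ge_zero)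
  qed
qed

theorem theorem3p12:
  fixes \<alpha> \<beta> \<gamma> a b c z :: complex and p :: real
  assumes "p \<ge> 0"
    and "Re \<alpha> > 0"
    and "Re b > 0"
    and "Re c > Re b"
    and "norm z < 1"
  shows "forward_difference (\<lambda>a'. hypergeom_ML \<alpha> \<beta> \<gamma> p a' b c z) a
    = b * z / c * hypergeom_ML \<alpha> \<beta> \<gamma> p (a + 1) (b + 1) (c + 1) z"
proof -
  define B where "B = beta_integral b (c - b)"
  define M where "M = (\<lambda>n. beta_ML \<alpha> \<beta> \<gamma> p (b + of_nat n) (c - b))"
  define u where "u = (\<lambda>a n. pochhammer a n * (M n / B) * (z ^ n / fact n))"
  \<comment> \<open>The terms of the right-hand series, with (c+1)-(b+1) already simplified to
    c-b.\<close>
  define v where "v = (\<lambda>n. pochhammer (a + 1) n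
    * (beta_ML \<alpha> \<beta> \<gamma> p ((b + 1) + of_nat n) (c - b) / beta_integral (b + 1) (c - b)) * (z ^ n / fact n))"
  have nz: "b \<noteq> 0" "c \<noteq> 0" using assms by auto
  have B: "beta_integral (b + 1) (c - b) = b / c * B"
    using beta_integral_plus1[of b "c - b"] assms nz unfolding B_def by (simp add: field_simps)
  have u: "summable (u a)" for a
    unfolding u_def M_def by (rule summable_hypergeom_ML) fact
  have v: "summable v"
    unfolding v_def by (rule summable_hypergeom_ML) fact
  have step: "u (a + 1) (Suc n) - u a (Suc n) = b * z / c * v n" for n
  proof -
    have "u (a + 1) (Suc n) - u a (Suc n)
        = (pochhammer (a + 1) (Suc n) - pochhammer a (Suc n)) * (M (Suc n) / B) * (z ^ Suc n / fact (Suc n))"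
      by (simp only: u_def left_diff_distrib)
    also have "\<dots> = z * (pochhammer (a + 1) n * (M (Suc n) / B) * (z ^ n / fact n))"
      unfolding pochhammer_forward_difference fact_Suc power_Suc
      by (simp add: divide_simps del: of_nat_Suc)
    \<comment> \<open>The numerators agree since b+(n+1) = (b+1)+n; the prefactor b/c cancels the
      one in the denominator of \<open>v\<close>.\<close>
    also have "\<dots> = b * z / c * v n"
      using nz unfolding v_def M_def B by (simp add: add_ac)
    finally show ?thesis .
  qed
  have "forward_difference (\<lambda>a'. hypergeom_ML \<alpha> \<beta> \<gamma> p a' b c z) a = suminf (u (a + 1)) - suminf (u a)"
    by (simp add: forward_difference_def hypergeom_ML_def u_def M_def B_def)
  also have "\<dots> = (\<Sum>n. u (a + 1) n - u a n)"
    by (rule suminf_diff[OF u u])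
  \<comment> \<open>The terms at index 0 cancel, since (a+1)_0 = (a)_0 = 1.\<close>
  also have "\<dots> = (\<Sum>n. u (a + 1) (Suc n) - u a (Suc n))"
    using suminf_split_head[OF summable_diff[OF u u], of "a + 1" a] by (simp add: u_def)
  also have "\<dots> = b * z / c * suminf v"
    by (simp only: step suminf_mult[OF v])
  also have "suminf v = hypergeom_ML \<alpha> \<beta> \<gamma> p (a + 1) (b + 1) (c + 1) z"
    by (simp add: hypergeom_ML_def v_def)
  finally show ?thesis .
qed

end
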